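(* Let $k\ge 2$ and let $p=\left(1-2^{-2k/\alpha(n)}\right)^{1/k}$ with $\alpha(n)=\omega(1)$ and $n$ large enough that $p\le 1/2$. Let $Q:\{0,1\}^k\to\mathbb{R}$ be a probability distribution such that $Q(1^k)=0$ and such that for every $i\in[k]$, marginalizing out the $i$-th bit of $Q$ yields the distribution of $k-1$ independent bits each equal to $1$ with probability $p$. Then $Q=\mathcal{P}_k$, where $\mathcal{P}_k(x)=p^m(1-p)^{k-m}-(-1)^{k-m}p^k$ and $m$ denotes the number of ones in $x$.
   Context: $\mathcal{P}_k$ is the distribution on $\{0,1\}^k$ given by the displayed formula; it arises as the per-coordinate distribution of $k$ planted vectors obtained by taking $k$ independent $p$-biased bits, letting $m$ be their number of ones, and, if $k-m$ is even, flipping the last bit with probability $(p/(1-p))^{k-m}$. *)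

theory Defs
  imports "HOL-Probability.Probability"
begin

text \<open>
  A bit vector indexed by a set \<open>S\<close> of coordinates is a Boolean function that is
  \<open>False\<close> outside \<open>S\<close>; this is the convention of \<^const>\<open>Pi_pmf\<close> with default value \<open>False\<close>.
  The coordinates \<open>1, \<dots>, k\<close> are numbered \<open>0, \<dots>, k - 1\<close>.
\<close>

definition cube :: "nat \<Rightarrow> (nat \<Rightarrow> bool) set" where
  "cube k = PiE_dflt {..<k} False (\<lambda>_. UNIV)"

definition all_ones :: "nat \<Rightarrow> nat \<Rightarrow> bool" where
  "all_ones k = (\<lambda>i. i < k)"

definition num_ones :: "nat \<Rightarrow> (nat \<Rightarrow> bool) \<Rightarrow> nat" where
  "num_ones k x = card {i. i < k \<and> x i}"

text \<open>
  Forgetting coordinate \<open>i\<close> means resetting it to the default value, so the result lives on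
  the cube with coordinate set \<open>{..<k} - {i}\<close>.
\<close>

definition marginalize_out :: "nat \<Rightarrow> (nat \<Rightarrow> bool) pmf \<Rightarrow> (nat \<Rightarrow> bool) pmf" where
  "marginalize_out i Q = map_pmf (\<lambda>x. x(i := False)) Q"

definition planted_prob :: "nat \<Rightarrow> real \<Rightarrow> (nat \<Rightarrow> bool) \<Rightarrow> real" where
  "planted_prob k p x =
     (let m = num_ones k x in p ^ m * (1 - p) ^ (k - m) - (-1) ^ (k - m) * p ^ k)"

end

theory Submission imports Defs begin

text \<open>
  The marginal condition for a coordinate \<open>i\<close> with \<open>x i = 0\<close> fixes the sum of \<open>Q x\<close> and
  \<open>Q (x(i := 1))\<close>. Hence \<open>Q\<close> is determined by its value at the all-ones vector, by induction on
  the number of zeros, and the claimed formula solves the resulting recurrence.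
\<close>

lemma mem_cube_iff: "x \<in> cube k \<longleftrightarrow> (\<forall>i. x i \<longrightarrow> i < k)"
  by (auto simp: cube_def PiE_dflt_def)

lemma num_ones_le: "num_ones k x \<le> k"
proof -
  have "card {i. i < k \<and> x i} \<le> card {..<k}"
    by (rule card_mono) auto
  then show ?thesis
    by (simp add: num_ones_def)
qed

lemma num_ones_upd_True:
  assumes "i < k" "\<not> x i"
  shows "num_ones k (x(i := True)) = Suc (num_ones k x)"
proof -
  have "{j. j < k \<and> (x(i := True)) j} = insert i {j. j < k \<and> x j}"
    using assms by auto
  then show ?thesis
    using assms by (simp add: num_ones_def)
qed

text \<open>The fibre of \<open>x\<close> under resetting coordinate \<open>i\<close> consists of
  the two distinct points \<open>x\<close> and \<open>x(i := True)\<close>, since \<open>x\<close>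
  already has the default value at \<open>i\<close>.\<close>

lemma pmf_marginalize_out:
  assumes "\<not> x i"
  shows "pmf (marginalize_out i Q) x = pmf Q x + pmf Q (x(i := True))"
proof -
  have "(\<lambda>z. z(i := False)) -` {x} = {x, x(i := True)}"
  proof (intro set_eqI iffI)
    fix z assume "z \<in> (\<lambda>z. z(i := False)) -` {x}"
    then have "x = z(i := False)" by simp
    then show "z \<in> {x, x(i := True)}"
      by (cases "z i") (auto simp: fun_eq_iff)
  qed (use assms in \<open>auto simp: fun_eq_iff\<close>)
  moreover have "x \<noteq> x(i := True)"
    using assms by (metis fun_upd_same)
  ultimately show ?thesis
    by (simp add: marginalize_out_def pmf_map measure_measure_pmf_finite)
qed

lemma pmf_Pi_bernoulli_cube:
  assumes "x \<in> cube k" "i < k" "\<not> x i" "0 \<le> p" "p \<le> 1"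
  shows "pmf (Pi_pmf ({..<k} - {i}) False (\<lambda>_. bernoulli_pmf p)) x =
    p ^ num_ones k x * (1 - p) ^ (k - 1 - num_ones k x)"
proof -
  let ?A = "{..<k} - {i}"
  have ones: "?A \<inter> {j. x j} = {j. j < k \<and> x j}"
    using assms(3) by auto
  have "card (?A \<inter> - {j. x j}) = card ?A - card (?A \<inter> {j. x j})"
    by (simp add: card_Diff_subset_Int flip: Diff_eq)
  then have zeros: "card (?A \<inter> - {j. x j}) = k - 1 - num_ones k x"
    using assms(2) by (simp add: ones num_ones_def)
  have "pmf (Pi_pmf ?A False (\<lambda>_. bernoulli_pmf p)) x
      = (\<Prod>j\<in>?A. pmf (bernoulli_pmf p) (x j))"
    \<comment> \<open>\<open>x\<close> takes the default value \<open>False\<close> outside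
      \<open>?A\<close>, at \<open>i\<close> as well as beyond \<open>k\<close>; otherwise the mass
      would be 0.\<close>
    using assms(1,3) by (subst pmf_Pi) (auto simp: mem_cube_iff)
  also have "\<dots> = (\<Prod>j\<in>?A. if x j then p else 1 - p)"
    using assms(4,5) by (intro prod.cong) auto
  also have "\<dots> = p ^ card (?A \<inter> {j. x j}) * (1 - p) ^ card (?A \<inter> - {j. x j})"
    by (subst prod.If_cases) auto
  finally show ?thesis
    unfolding zeros unfolding ones num_ones_def .
qed

lemma planted_prob_all_ones: "planted_prob k p (all_ones k) = 0"
  by (simp add: planted_prob_def num_ones_def all_ones_def)

text \<open>Raising one bit changes the parity of the number of zeros, so the two terms in
  \<open>p ^ k\<close> cancel. The remaining products share the factor on the right, with weights
  \<open>1 - p\<close> and \<open>p\<close> that add up to 1.\<close>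

lemma planted_prob_upd_True:
  assumes "i < k" "\<not> x i"
  shows "planted_prob k p x + planted_prob k p (x(i := True)) =
    p ^ num_ones k x * (1 - p) ^ (k - 1 - num_ones k x)"
proof -
  have "Suc (num_ones k x) \<le> k"
    using num_ones_le[of k "x(i := True)"] by (simp add: num_ones_upd_True assms)
  \<comment> \<open>\<open>d\<close> counts the zeros of \<open>x\<close> other than
    \<open>i\<close>; it replaces the truncated subtractions.\<close>
  then obtain d where "k = Suc (num_ones k x) + d"
    using le_Suc_ex by blast
  then have "k - num_ones k x = Suc d" "k - Suc (num_ones k x) = d" "k - 1 - num_ones k x = d"
    by linarith+
  then show ?thesis
    by (simp add: planted_prob_def num_ones_upd_True assms Let_def algebra_simps)
qed

lemma pmf_eq_planted_prob:
  assumes p: "0 \<le> p" "p \<le> 1"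
    and Q1: "pmf Q (all_ones k) = 0"
    and marginal: "\<And>i. i < k \<Longrightarrow>
      marginalize_out i Q = Pi_pmf ({..<k} - {i}) False (\<lambda>_. bernoulli_pmf p)"
    and "x \<in> cube k"
  shows "pmf Q x = planted_prob k p x"
  using \<open>x \<in> cube k\<close>
proof (induction "k - num_ones k x" arbitrary: x rule: less_induct)
  case less
  show ?case
  proof (cases "\<exists>i<k. \<not> x i")
    case False
    \<comment> \<open>Membership in \<open>cube k\<close> settles the coordinates from
      \<open>k\<close> on, where both sides are \<open>False\<close>.\<close>
    then have "x = all_ones k"
      using less.prems by (auto simp: mem_cube_iff all_ones_def fun_eq_iff)
    then show ?thesis
      by (simp add: Q1 planted_prob_all_ones)
  next
    case True
    then obtain i where i: "i < k" "\<not> x i" by blast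
    let ?y = "x(i := True)"
    have "k - num_ones k ?y < k - num_ones k x"
      using num_ones_le[of k ?y] by (simp add: num_ones_upd_True i)
    moreover have "?y \<in> cube k"
      using less.prems i by (auto simp: mem_cube_iff)
    ultimately have "pmf Q ?y = planted_prob k p ?y"
      by (rule less.hyps)
    \<comment> \<open>Both sums equal the mass that the product of the other \<open>k - 1\<close>
      biased bits gives to \<open>x\<close>.\<close>
    moreover have "pmf Q x + pmf Q ?y = planted_prob k p x + planted_prob k p ?y"
      using pmf_marginalize_out[of x i Q] marginal[of i]
        pmf_Pi_bernoulli_cube[OF less.prems i p] planted_prob_upd_True[of i k x p] i
      by simp
    ultimately show ?thesis by simp
  qed
qed

theorem theorem7:
  fixes k n :: nat and \<alpha> :: "nat \<Rightarrow> real" and p :: real and Q :: "(nat \<Rightarrow> bool) pmf"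
  assumes "k \<ge> 2"
    and "filterlim \<alpha> at_top sequentially"
    and "\<alpha> n > 0"
    and "p = (1 - 2 powr (- (2 * real k / \<alpha> n))) powr (1 / real k)"
    and "p \<le> 1 / 2"
    and "set_pmf Q \<subseteq> cube k"
    and "pmf Q (all_ones k) = 0"
    and "\<And>i. i < k \<Longrightarrow>
           marginalize_out i Q = Pi_pmf ({..<k} - {i}) False (\<lambda>_. bernoulli_pmf p)"
  shows "\<forall>x \<in> cube k. pmf Q x = planted_prob k p x"
proof
  fix x assume x: "x \<in> cube k"
  \<comment> \<open>The lower bound holds because \<open>p\<close> is a value of
    \<open>powr\<close>, the upper one because \<open>p \<le> 1 / 2\<close>.\<close>
  have "0 \<le> p" "p \<le> 1"
    using assms(4,5) by auto
  then show "pmf Q x = planted_prob k p x"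
    by (rule pmf_eq_planted_prob) (use assms(7,8) x in auto)
qed

end
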